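(* Let $K\ge 1$. Every normalized vector $|\Psi\rangle$ in the antisymmetric space $\mathcal{A}(\mathbb{C}^{2K}\otimes\mathbb{C}^{2K})$ can be represented, in an appropriately chosen orthonormal basis of $\mathbb{C}^{2K}$, in the form $$|\Psi\rangle=\frac{1}{\sqrt{\sum_{i=1}^K |z_i|^2}}\sum_{i=1}^{K}z_i\, f_{a_{1}(i)}^{\dagger}f_{a_{2}(i)}^{\dagger}|\Omega\rangle,$$ with complex numbers $z_1,\dots,z_K$, where the $2K$ single-particle states $f_{a_{1}(i)}^{\dagger}|\Omega\rangle$, $f_{a_{2}(i)}^{\dagger}|\Omega\rangle$, $i=1,\ldots,K$, form an orthonormal basis of $\mathbb{C}^{2K}$ (so each of these single-particle states occurs in only one term of the sum).
   Context: $\mathcal{A}(\mathbb{C}^{2K}\otimes\mathbb{C}^{2K})$ is the antisymmetric subspace, i.e. the space of states of two indistinguishable fermions with single-particle space $\mathbb{C}^{2K}$. For an orthonormal basis of $\mathbb{C}^{2K}$ labelled by $a=1,\dots,2K$, the operators $f_a,f_a^\dagger$ are the corresponding fermionic annihilation and creation operators (satisfying the canonical anticommutation relations) and $|\Omega\rangle$ is the vacuum. The state $f_a^\dagger f_b^\dagger|\Omega\rangle$ ($a\neq b$) is the normalized elementary Slater determinant $\frac{1}{\sqrt2}(e_a\otimes e_b-e_b\otimes e_a)$, where $e_a=f_a^\dagger|\Omega\rangle$. Every vector of $\mathcal{A}(\mathbb{C}^{2K}\otimes\mathbb{C}^{2K})$ can be written as $\sum_{a,b}w_{ab}f_a^\dagger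 f_b^\dagger|\Omega\rangle$ with $w$ a complex antisymmetric $2K\times 2K$ matrix. The representation in the claim is called the Slater decomposition, and the number of nonvanishing $z_i$ in it is called the Slater rank of $|\Psi\rangle$. *)

theory Defs
  imports "HOL-Analysis.Analysis"
begin

text \<open>
  The single-particle space is \<open>complex^'n\<close>.  A vector of the full Fock space over it is given by its
  amplitudes \<open>'n list \<Rightarrow> complex\<close>: the value at \<open>[i\<^sub>1, \<dots>, i\<^sub>N]\<close> is the coefficient of
  \<open>e\<^sub>i\<^sub>1 \<otimes> \<dots> \<otimes> e\<^sub>i\<^sub>N\<close> for the standard basis of \<open>complex^'n\<close>.  The \<open>N\<close>-fold tensor power consists of
  the functions that vanish off the lists of length \<open>N\<close>.  Inner products are antilinear in the
  first argument.
\<close>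

type_synonym 'n fock = "'n list \<Rightarrow> complex"

definition cinner :: "complex ^ 'n \<Rightarrow> complex ^ 'n \<Rightarrow> complex" where
  "cinner u v = (\<Sum>i\<in>UNIV. cnj (u $ i) * v $ i)"

definition orthonormal_basis :: "'i set \<Rightarrow> ('i \<Rightarrow> complex ^ 'n) \<Rightarrow> bool" where
  "orthonormal_basis I e \<longleftrightarrow>
     (\<forall>a\<in>I. \<forall>b\<in>I. cinner (e a) (e b) = (if a = b then 1 else 0)) \<and> vec.span (e ` I) = UNIV"

definition tensor_inner :: "nat \<Rightarrow> 'n::finite fock \<Rightarrow> 'n fock \<Rightarrow> complex" where
  "tensor_inner N \<phi> \<psi> = (\<Sum>is | length is = N. cnj (\<phi> is) * \<psi> is)"

text \<open>Transposing any two tensor factors changes the sign.\<close>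

definition antisymmetric :: "'n fock \<Rightarrow> bool" where
  "antisymmetric \<psi> \<longleftrightarrow> (\<forall>xs i ys j zs. \<psi> (xs @ i # ys @ j # zs) = - \<psi> (xs @ j # ys @ i # zs))"

definition antisym_space :: "nat \<Rightarrow> 'n fock set" where
  "antisym_space N = {\<psi>. (\<forall>is. length is \<noteq> N \<longrightarrow> \<psi> is = 0) \<and> antisymmetric \<psi>}"

definition vacuum :: "'n fock" where
  "vacuum is = (if is = [] then 1 else 0)"

text \<open>
  The creation operator \<open>f\<^sup>\<dagger>(v)\<close> sends an antisymmetric \<open>\<psi>\<close> of \<open>N - 1\<close> particles to \<open>sqrt N\<close> times the
  antisymmetrization of \<open>v \<otimes> \<psi>\<close>; the annihilation operator is its adjoint.  For an orthonormal
  basis \<open>e\<close>, the mode operators \<open>f\<^sub>a\<^sup>\<dagger>\<close>, \<open>f\<^sub>a\<close> are \<open>creation (e a)\<close> and \<open>annihilation (e a)\<close>.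
\<close>

definition creation :: "complex ^ 'n \<Rightarrow> 'n fock \<Rightarrow> 'n fock" where
  "creation v \<psi> is =
     (\<Sum>k<length is. (-1) ^ k * v $ (is ! k) * \<psi> (take k is @ drop (Suc k) is))
       / complex_of_real (sqrt (length is))"

definition annihilation :: "complex ^ 'n \<Rightarrow> 'n::finite fock \<Rightarrow> 'n fock" where
  "annihilation v \<psi> is =
     complex_of_real (sqrt (length is + 1)) * (\<Sum>i\<in>UNIV. cnj (v $ i) * \<psi> (i # is))"

text \<open>The identification of the one-particle sector with \<open>complex^'n\<close>.\<close>

definition one_particle :: "'n fock \<Rightarrow> complex ^ 'n" where
  "one_particle \<phi> = (\<chi> i. \<phi> [i])"

definition tensor2 :: "complex ^ 'n \<Rightarrow> complex ^ 'n \<Rightarrow> 'n fock" where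
  "tensor2 u v is = (if length is = 2 then u $ (is ! 0) * v $ (is ! 1) else 0)"


lemma one_particle_creation_vacuum: "one_particle (creation v vacuum) = v"
  by (simp add: one_particle_def creation_def vacuum_def vec_eq_iff)

lemma creation_vacuum_off_sector: "length is \<noteq> 1 \<Longrightarrow> creation v vacuum is = 0"
  by (cases "is"; cases "tl is") (auto simp: creation_def vacuum_def intro!: sum.neutral)

lemma tensor_inner_creation_vacuum:
  "tensor_inner 1 (creation u vacuum) (creation v vacuum) = cinner u v"
proof -
  have "{is :: 'a list. length is = 1} = (\<lambda>i. [i]) ` UNIV"
    by (auto simp: length_Suc_conv)
  then show ?thesis
    by (simp add: tensor_inner_def cinner_def sum.reindex inj_on_def creation_def vacuum_def)
qed

lemma slater_determinant:
  "creation u (creation v vacuum) =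
     (\<lambda>is. (tensor2 u v is - tensor2 v u is) / complex_of_real (sqrt 2))"
proof
  fix "is" :: "'a list"
  consider "is = []" | i where "is = [i]" | i j where "is = [i, j]"
    | i j k js where "is = i # j # k # js"
    by (metis list.exhaust)
  then show "creation u (creation v vacuum) is =
      (tensor2 u v is - tensor2 v u is) / complex_of_real (sqrt 2)"
  proof cases
    case 4
    have "creation u (creation v vacuum) is = 0"
      unfolding creation_def[of u]
      by (subst sum.neutral) (auto simp: 4 creation_vacuum_off_sector)
    then show ?thesis by (simp add: 4 tensor2_def)
  qed (simp_all add: creation_def vacuum_def tensor2_def lessThan_Suc numeral_2_eq_2)
qed

lemma antisym_space_2_iff:
  "\<psi> \<in> antisym_space 2 \<longleftrightarrow>
     (\<forall>is. length is \<noteq> 2 \<longrightarrow> \<psi> is = 0) \<and> (\<forall>i j. \<psi> [i, j] = - \<psi> [j, i])"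
  (is "_ \<longleftrightarrow> ?R")
proof
  assume "\<psi> \<in> antisym_space 2"
  then have *: "\<forall>is. length is \<noteq> 2 \<longrightarrow> \<psi> is = 0"
    and **: "\<And>xs i ys j zs. \<psi> (xs @ i # ys @ j # zs) = - \<psi> (xs @ j # ys @ i # zs)"
    unfolding antisym_space_def antisymmetric_def by blast+
  have "\<psi> [i, j] = - \<psi> [j, i]" for i j
    using **[of "[]" i "[]" j "[]"] by simp
  then show ?R using * by blast
next
  assume R: ?R
  have "\<psi> (xs @ i # ys @ j # zs) = - \<psi> (xs @ j # ys @ i # zs)" for xs i ys j zs
  proof (cases "xs = [] \<and> ys = [] \<and> zs = []")
    case True
    have "\<psi> [i, j] = - \<psi> [j, i]" using R by blast
    then show ?thesis using True by simp
  next
    case False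
    then have "length (xs @ i # ys @ j # zs) \<noteq> 2" "length (xs @ j # ys @ i # zs) \<noteq> 2"
      by auto
    then have "\<psi> (xs @ i # ys @ j # zs) = 0" "\<psi> (xs @ j # ys @ i # zs) = 0"
      using R by blast+
    then show ?thesis by simp
  qed
  then show "\<psi> \<in> antisym_space 2"
    using R unfolding antisym_space_def antisymmetric_def by blast
qed


text \<open>
  On antisymmetric vectors the operators are mutually adjoint and satisfy the canonical
  anticommutation relations; creation operators preserve antisymmetry.
\<close>

definition ins :: "complex ^ 'n \<Rightarrow> 'n fock \<Rightarrow> 'n fock" where
  "ins v \<psi> is = (\<Sum>k<length is. (-1) ^ k * v $ (is ! k) * \<psi> (take k is @ drop (Suc k) is))"

lemma creation_ins: "creation v \<psi> is = ins v \<psi> is / complex_of_real (sqrt (length is))"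
  by (simp add: creation_def ins_def)

lemma ins_Nil: "ins v \<psi> [] = 0"
  by (simp add: ins_def)

lemma ins_Cons: "ins v \<psi> (i # is) = v $ i * \<psi> is - ins v (\<lambda>js. \<psi> (i # js)) is"
  unfolding ins_def
  by (simp add: sum.lessThan_Suc_shift sum_negf del: sum.lessThan_Suc)

lemma ins_diff: "ins v (\<lambda>js. \<phi> js - \<psi> js) is = ins v \<phi> is - ins v \<psi> is"
  by (simp add: ins_def sum_subtractf right_diff_distrib)

lemma ins_minus: "ins v (\<lambda>js. - \<psi> js) is = - ins v \<psi> is"
  by (simp add: ins_def sum_negf)

lemma ins_mult: "ins v (\<lambda>js. c * \<psi> js) is = c * ins v \<psi> is"
  by (simp add: ins_def sum_distrib_left mult_ac)

lemma ins_cong: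
  "(\<And>js. length js = length is - 1 \<Longrightarrow> \<phi> js = \<psi> js) \<Longrightarrow> ins v \<phi> is = ins v \<psi> is"
  unfolding ins_def by (rule sum.cong) auto

lemma ins_ins: "ins u (ins v \<psi>) is = - ins v (ins u \<psi>) is"
proof (induction "is" arbitrary: \<psi>)
  case (Cons i "is")
  show ?case
    by (simp add: ins_Cons ins_diff ins_mult Cons[of "\<lambda>js. \<psi> (i # js)"])
qed (simp add: ins_Nil)

lemma creation_creation:
  "creation u (creation v \<psi>) is =
     ins u (ins v \<psi>) is / complex_of_real (sqrt (length is) * sqrt (length is - 1))"
proof -
  have "ins u (creation v \<psi>) is =
      ins u (\<lambda>js. 1 / complex_of_real (sqrt (length is - 1)) * ins v \<psi> js) is"
    by (cases "is = []") (auto simp: ins_Nil creation_ins intro!: ins_cong)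
  then show ?thesis by (simp only: creation_ins[of u] ins_mult) (simp add: mult_ac)
qed

lemma CAR_creation_creation:
  "creation u (creation v \<psi>) is + creation v (creation u \<psi>) is = 0"
  using ins_ins[of u v \<psi> "is"] by (simp add: creation_creation)

lemma CAR_annihilation_annihilation:
  assumes "antisymmetric \<psi>"
  shows "annihilation u (annihilation v \<psi>) is + annihilation v (annihilation u \<psi>) is = 0"
proof -
  have *: "\<psi> (j # i # is) = - \<psi> (i # j # is)" for i j
    using assms[unfolded antisymmetric_def, rule_format, of "[]" j "[]" i "is"] by simp
  have "(\<Sum>i\<in>UNIV. \<Sum>j\<in>UNIV. cnj (u $ i) * (cnj (v $ j) * \<psi> (j # i # is))) =
      (\<Sum>j\<in>UNIV. \<Sum>i\<in>UNIV. cnj (u $ i) * (cnj (v $ j) * \<psi> (j # i # is)))"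
    by (rule sum.swap)
  also have "\<dots> = - (\<Sum>j\<in>UNIV. \<Sum>i\<in>UNIV. cnj (v $ j) * (cnj (u $ i) * \<psi> (i # j # is)))"
    by (subst *) (simp add: sum_negf mult_ac)
  finally show ?thesis
    by (simp add: annihilation_def sum_distrib_left mult.left_commute[of "cnj _" "complex_of_real _"])
       (simp flip: sum_distrib_left distrib_left)
qed

lemma CAR_annihilation_creation:
  "annihilation u (creation v \<psi>) is + creation v (annihilation u \<psi>) is = cinner u v * \<psi> is"
proof -
  have ann: "annihilation u (creation v \<psi>) is = (\<Sum>i\<in>UNIV. cnj (u $ i) * ins v \<psi> (i # is))"
    by (simp add: annihilation_def creation_ins add.commute flip: sum_divide_distrib)
  have "ins v (annihilation u \<psi>) is =
      ins v (\<lambda>js. complex_of_real (sqrt (length is)) * (\<Sum>i\<in>UNIV. cnj (u $ i) * \<psi> (i # js))) is"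
    by (cases "is = []") (auto simp: ins_Nil annihilation_def intro!: ins_cong)
  also have "\<dots> = complex_of_real (sqrt (length is)) *
      (\<Sum>i\<in>UNIV. cnj (u $ i) * ins v (\<lambda>js. \<psi> (i # js)) is)"
    unfolding ins_mult
    by (simp add: ins_def sum_distrib_left mult_ac) (subst sum.swap, simp)
  finally have cre: "creation v (annihilation u \<psi>) is =
      (\<Sum>i\<in>UNIV. cnj (u $ i) * ins v (\<lambda>js. \<psi> (i # js)) is)"
    by (cases "is = []") (simp_all add: creation_ins ins_Nil)
  show ?thesis
    unfolding ann cre
    by (simp add: ins_Cons cinner_def sum_distrib_left right_diff_distrib sum_subtractf mult_ac)
qed

lemma antisymmetric_adjacentI:
  assumes "\<And>xs i j zs. \<psi> (xs @ i # j # zs) = - \<psi> (xs @ j # i # zs)"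
  shows "antisymmetric \<psi>"
proof -
  have "\<psi> (xs @ i # ys @ j # zs) = - \<psi> (xs @ j # ys @ i # zs)" for xs i ys j zs
  proof (induction ys arbitrary: xs)
    case Nil
    show ?case using assms[of xs i j zs] by simp
  next
    case (Cons m ys)
    have "\<psi> (xs @ i # m # ys @ j # zs) = - \<psi> ((xs @ [m]) @ i # ys @ j # zs)"
      using assms[of xs i m] by simp
    also have "\<dots> = \<psi> (xs @ m # j # ys @ i # zs)" using Cons[of "xs @ [m]"] by simp
    also have "\<dots> = - \<psi> (xs @ j # m # ys @ i # zs)" by (rule assms)
    finally show ?case by simp
  qed
  then show ?thesis unfolding antisymmetric_def by blast
qed

lemma antisymmetric_Cons: "antisymmetric \<psi> \<Longrightarrow> antisymmetric (\<lambda>js. \<psi> (x # js))"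
  unfolding antisymmetric_def by (metis append_Cons)

lemma antisymmetric_swap: "antisymmetric \<psi> \<Longrightarrow> \<psi> (i # j # js) = - \<psi> (j # i # js)"
  unfolding antisymmetric_def by (metis append_Nil)

lemma ins_antisymmetric:
  "antisymmetric \<psi> \<Longrightarrow> ins v \<psi> (xs @ i # j # zs) = - ins v \<psi> (xs @ j # i # zs)"
proof (induction xs arbitrary: \<psi>)
  case Nil
  have "ins v (\<lambda>js. \<psi> (i # j # js)) zs = - ins v (\<lambda>js. \<psi> (j # i # js)) zs"
    unfolding ins_minus[symmetric] using antisymmetric_swap[OF Nil] by metis
  then show ?case by (simp add: ins_Cons)
next
  case (Cons x xs)
  have "\<psi> (xs @ i # j # zs) = - \<psi> (xs @ j # i # zs)"
    using Cons.prems[unfolded antisymmetric_def, rule_format, of xs i "[]" j zs] by simp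
  then show ?case
    using Cons.IH[OF antisymmetric_Cons[OF Cons.prems]] by (simp add: ins_Cons)
qed

lemma creation_antisym_space:
  assumes "\<psi> \<in> antisym_space N"
  shows "creation v \<psi> \<in> antisym_space (Suc N)"
proof -
  have "creation v \<psi> is = 0" if "length is \<noteq> Suc N" for "is"
    using assms that by (auto simp: creation_def antisym_space_def intro!: sum.neutral)
  moreover have "antisymmetric (creation v \<psi>)"
  proof (rule antisymmetric_adjacentI)
    fix xs i j zs
    have "antisymmetric \<psi>" using assms by (simp add: antisym_space_def)
    from ins_antisymmetric[OF this, of v xs i j zs]
    show "creation v \<psi> (xs @ i # j # zs) = - creation v \<psi> (xs @ j # i # zs)"
      by (simp add: creation_ins)
  qed
  ultimately show ?thesis unfolding antisym_space_def by blast
qed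

lemma sum_length_Suc:
  "(\<Sum>is | length is = Suc N. f is) = (\<Sum>i\<in>UNIV. \<Sum>is | length is = N. f (i # is))"
  for f :: "'n::finite list \<Rightarrow> complex"
proof -
  have "{is :: 'n list. length is = Suc N} = (\<lambda>(i, is). i # is) ` (UNIV \<times> {is. length is = N})"
    by (auto simp: length_Suc_conv image_iff)
  then show ?thesis
    by (simp add: sum.reindex inj_on_def case_prod_unfold sum.cartesian_product)
qed

lemma ins_adjoint:
  fixes \<phi> \<psi> :: "'n::finite fock"
  shows "antisymmetric \<phi> \<Longrightarrow> (\<Sum>is | length is = Suc N. cnj (\<phi> is) * ins v \<psi> is) =
    of_nat (Suc N) * (\<Sum>i\<in>UNIV. \<Sum>is | length is = N. cnj (\<phi> (i # is)) * (v $ i * \<psi> is))"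
proof (induction N arbitrary: \<phi> \<psi>)
  case 0
  then show ?case by (simp add: sum_length_Suc ins_Cons ins_Nil)
next
  case (Suc N)
  let ?S = "\<Sum>i\<in>UNIV. \<Sum>is | length is = Suc N. cnj (\<phi> (i # is)) * (v $ i * \<psi> is)"
  have "(\<Sum>is | length is = Suc N. cnj (\<phi> (i # is)) * ins v (\<lambda>js. \<psi> (i # js)) is) =
      - of_nat (Suc N) * (\<Sum>j\<in>UNIV. \<Sum>is | length is = N. cnj (\<phi> (j # i # is)) * (v $ j * \<psi> (i # is)))"
    for i
    unfolding Suc.IH[OF antisymmetric_Cons[OF Suc.prems]]
    by (subst antisymmetric_swap[OF Suc.prems]) (simp add: sum_negf del: of_nat_Suc)
  then have "(\<Sum>i\<in>UNIV. \<Sum>is | length is = Suc N. cnj (\<phi> (i # is)) * ins v (\<lambda>js. \<psi> (i # js)) is) =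
      - of_nat (Suc N) * (\<Sum>i\<in>UNIV. \<Sum>j\<in>UNIV. \<Sum>is | length is = N.
        cnj (\<phi> (j # i # is)) * (v $ j * \<psi> (i # is)))"
    by (simp only: sum_distrib_left)
  also have "\<dots> = - of_nat (Suc N) * ?S"
    by (subst sum.swap) (simp only: sum_length_Suc)
  finally have "(\<Sum>i\<in>UNIV. \<Sum>is | length is = Suc N. cnj (\<phi> (i # is)) * ins v \<psi> (i # is)) =
      ?S + of_nat (Suc N) * ?S"
    by (simp only: ins_Cons right_diff_distrib sum_subtractf) (simp add: algebra_simps)
  then show ?case by (subst sum_length_Suc) (simp add: algebra_simps)
qed

lemma annihilation_adjoint:
  assumes "antisymmetric \<phi>"
  shows "tensor_inner N (annihilation v \<phi>) \<psi> = tensor_inner (Suc N) \<phi> (creation v \<psi>)"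
proof -
  let ?S = "\<Sum>i\<in>UNIV. \<Sum>is | length is = N. cnj (\<phi> (i # is)) * (v $ i * \<psi> is)"
  have "tensor_inner (Suc N) \<phi> (creation v \<psi>) =
      (\<Sum>is | length is = Suc N. cnj (\<phi> is) * ins v \<psi> is) / complex_of_real (sqrt (Suc N))"
    by (simp add: tensor_inner_def creation_ins sum_divide_distrib)
  also have "\<dots> = of_nat (Suc N) / complex_of_real (sqrt (Suc N)) * ?S"
    by (simp only: ins_adjoint[OF assms]) simp
  also have "of_nat (Suc N) / complex_of_real (sqrt (Suc N)) = complex_of_real (sqrt (Suc N))"
    by (metis of_real_divide of_real_of_nat_eq real_div_sqrt of_nat_0_le_iff)
  also have "complex_of_real (sqrt (Suc N)) * ?S = tensor_inner N (annihilation v \<phi>) \<psi>"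
    unfolding tensor_inner_def annihilation_def
    by (subst sum.swap) (simp add: sum_distrib_left sum_distrib_right mult_ac add.commute)
  finally show ?thesis by simp
qed

end

theory Submission
  imports Defs
begin

text \<open>
  In an orthonormal basis \<open>e\<close> the coefficients of \<open>\<Psi>\<close> are \<open>B(e\<^sub>a, e\<^sub>b)\<close> for the antisymmetric,
  conjugate-bilinear form \<open>B(x, y) = \<Sum>\<^sub>i\<^sub>j \<Psi>\<^sub>i\<^sub>j cnj x\<^sub>i cnj y\<^sub>j\<close>.  Let \<open>(u, v)\<close> maximize \<open>|B|\<close> over the
  orthonormal pairs of a subspace; such a pair exists by compactness.  Maximality forces
  \<open>B(u, y) = B(v, y) = 0\<close> for every \<open>y\<close> of the subspace orthogonal to \<open>u\<close> and \<open>v\<close>, so the argument can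
  be repeated in the orthogonal complement of \<open>{u, v}\<close>.  After \<open>K\<close> steps the pairs form an orthonormal
  basis in which \<open>B\<close> is block diagonal with antisymmetric \<open>2 \<times> 2\<close> blocks.
\<close>

subsection \<open>The Hermitian inner product\<close>

lemma cinner_add_left: "cinner (x + y) z = cinner x z + cinner y z"
  by (simp add: cinner_def distrib_right sum.distrib)

lemma cinner_add_right: "cinner z (x + y) = cinner z x + cinner z y"
  by (simp add: cinner_def distrib_left sum.distrib)

lemma cinner_diff_right: "cinner z (x - y) = cinner z x - cinner z y"
  by (simp add: cinner_def right_diff_distrib sum_subtractf)

lemma cinner_scale_left: "cinner (c *s x) y = cnj c * cinner x y"
  by (simp add: cinner_def sum_distrib_left mult_ac)

lemma cinner_scale_right: "cinner x (c *s y) = c * cinner x y"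
  by (simp add: cinner_def sum_distrib_left mult_ac)

lemma cinner_sum_right: "cinner x (\<Sum>a\<in>A. f a) = (\<Sum>a\<in>A. cinner x (f a))"
  unfolding cinner_def by (subst sum.swap) (simp add: sum_distrib_left)

lemma cinner_commute: "cinner x y = cnj (cinner y x)"
  by (simp add: cinner_def mult.commute)

lemma cinner_eq_0_commute: "cinner x y = 0 \<longleftrightarrow> cinner y x = 0"
  by (metis cinner_commute complex_cnj_zero)

lemma cnj_mult_self: "cnj c * c = (complex_of_real (cmod c))\<^sup>2"
  by (metis complex_norm_square mult.commute of_real_power)

lemma cinner_self: "cinner x x = complex_of_real ((norm x)\<^sup>2)"
proof -
  have "(norm x)\<^sup>2 = (\<Sum>i\<in>UNIV. (cmod (x $ i))\<^sup>2)"
    by (simp add: norm_vec_def L2_set_def sum_nonneg)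
  then show ?thesis
    by (simp add: cinner_def cnj_mult_self)
qed

lemma cinner_self_eq_1: "cinner x x = 1 \<longleftrightarrow> norm x = 1"
  by (simp only: cinner_self of_real_eq_1_iff) (simp add: power2_eq_1_iff, smt (verit) norm_ge_zero)

lemma norm_normalize:
  assumes "x \<noteq> 0"
  shows "norm (complex_of_real (inverse (norm x)) *s x) = 1"
proof -
  have "complex_of_real r *s x = r *\<^sub>R x" for r
    by (simp add: vec_eq_iff) (simp add: scaleR_conv_of_real)
  then show ?thesis using assms by (simp del: of_real_inverse)
qed

section \<open>Orthonormal families, their extension and completeness\<close>

definition orthonormal :: "'i set \<Rightarrow> ('i \<Rightarrow> complex ^ 'n) \<Rightarrow> bool" where
  "orthonormal I e \<longleftrightarrow> (\<forall>a\<in>I. \<forall>b\<in>I. cinner (e a) (e b) = (if a = b then 1 else 0))"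

lemma orthonormal_insert:
  assumes "orthonormal I e" "norm (e a) = 1" "\<forall>b\<in>I. cinner (e b) (e a) = 0"
  shows "orthonormal (insert a I) e"
proof -
  have "cinner (e a) (e b) = 0" if "b \<in> I" for b
    using assms(3) that cinner_eq_0_commute by blast
  moreover have "cinner (e a) (e a) = 1"
    using assms(2) by (simp only: cinner_self_eq_1)
  ultimately show ?thesis
    using assms unfolding orthonormal_def by (metis insert_iff zero_neq_one)
qed

text \<open>The sum is the orthogonal projection of \<open>x\<close> onto the span of the family, so
  subtracting it leaves a vector orthogonal to every \<open>e a\<close>.\<close>

lemma cinner_projection:
  assumes "orthonormal I e" "finite I" "a \<in> I"
  shows "cinner (e a) (\<Sum>b\<in>I. cinner (e b) x *s e b) = cinner (e a) x"
proof -
  have "cinner (e a) (\<Sum>b\<in>I. cinner (e b) x *s e b) =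
      (\<Sum>b\<in>I. cinner (e b) x * (if a = b then 1 else 0))"
    using assms by (simp add: cinner_sum_right cinner_scale_right orthonormal_def)
  also have "\<dots> = (\<Sum>b\<in>I. if b = a then cinner (e b) x else 0)"
    by (intro sum.cong) auto
  finally show ?thesis using assms by simp
qed

text \<open>One Gram-Schmidt step: fewer than \<open>CARD('n)\<close> vectors cannot span, and a
  vector outside the span minus its projection is nonzero and can be normalized.\<close>

lemma orthonormal_extend:
  fixes e :: "'i \<Rightarrow> complex ^ 'n"
  assumes "orthonormal I e" "finite I" "card I < CARD('n)"
  obtains x where "norm x = 1" "\<forall>a\<in>I. cinner (e a) x = 0"
proof -
  have "vec.dim (e ` I) \<le> card (e ` I)"
    using assms(2) by (intro vec.dim_le_card') auto
  also have "\<dots> \<le> card I" using assms(2) by (rule card_image_le)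
  finally have "vec.span (e ` I) \<noteq> (UNIV :: (complex ^ 'n) set)"
    using assms(3) vec.dim_span[of "e ` I"] vec_dim_card[where 'a=complex and 'n='n] by force
  then obtain y where y: "y \<notin> vec.span (e ` I)" by blast
  let ?p = "\<Sum>b\<in>I. cinner (e b) y *s e b"
  have "?p \<in> vec.span (e ` I)"
    by (intro vec.span_sum vec.span_scale vec.span_base) auto
  then have "norm (y - ?p) > 0" using y by auto
  moreover have "\<forall>a\<in>I. cinner (e a) (y - ?p) = 0"
    using cinner_projection[OF assms(1,2), of _ y] by (simp add: cinner_diff_right)
  ultimately obtain d where d: "norm d > 0" "\<forall>a\<in>I. cinner (e a) d = 0" by blast
  let ?x = "complex_of_real (inverse (norm d)) *s d"
  have "norm ?x = 1"
    using d(1) by (intro norm_normalize) auto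
  moreover have "\<forall>a\<in>I. cinner (e a) ?x = 0"
    using d(2) by (simp add: cinner_scale_right)
  ultimately show ?thesis by (rule that)
qed

text \<open>A nonzero vector orthogonal to the whole family would yield \<open>CARD('n) + 1\<close>
  independent vectors. Hence \<open>x\<close> minus its projection vanishes, which gives the
  expansion and with it the spanning property.\<close>

lemma orthonormal_spanning:
  fixes e :: "'i \<Rightarrow> complex ^ 'n"
  assumes "orthonormal I e" "finite I" "card I = CARD('n)"
  shows "orthonormal_basis I e" and "(\<Sum>a\<in>I. cinner (e a) x *s e a) = x"
proof -
  have inj: "inj_on e I"
    using assms(1) unfolding orthonormal_def inj_on_def by (metis zero_neq_one)
  have zero: "y = 0" if "\<forall>a\<in>I. cinner (e a) y = 0" for y
  proof (rule ccontr)
    assume "y \<noteq> 0"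
    have "vec.independent (insert y (e ` I))"
    proof (rule vec.independent_if_scalars_zero)
      fix f v
      assume s: "(\<Sum>v\<in>insert y (e ` I). f v *s v) = 0" and v: "v \<in> insert y (e ` I)"
      \<comment> \<open>Pairing the linear relation with \<open>v\<close> isolates its coefficient,
        since the other vectors are orthogonal to \<open>v\<close>.\<close>
      have "cinner v w = 0" if "w \<in> insert y (e ` I)" "w \<noteq> v" for w
        using that v \<open>\<forall>a\<in>I. cinner (e a) y = 0\<close> assms(1) cinner_eq_0_commute
        unfolding orthonormal_def by fastforce
      then have "(\<Sum>w\<in>insert y (e ` I). f w * cinner v w) = f v * cinner v v"
        using v assms(2) by (subst sum.remove[of _ v]) auto
      moreover have "(\<Sum>w\<in>insert y (e ` I). f w * cinner v w) = cinner v (\<Sum>w\<in>insert y (e ` I). f w *s w)"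
        by (simp only: cinner_sum_right cinner_scale_right)
      moreover have "cinner v v \<noteq> 0"
        using v \<open>y \<noteq> 0\<close> assms(1) unfolding orthonormal_def
        by (cases "v = y") (simp add: cinner_self, fastforce)
      ultimately show "f v = 0" using s by (simp add: cinner_def)
    qed (use assms(2) in auto)
    then have "card (insert y (e ` I)) \<le> CARD('n)"
      using vec.independent_card_le_dim[of "insert y (e ` I)" UNIV]
        vec_dim_card[where 'a=complex and 'n='n] by simp
    moreover have "y \<notin> e ` I"
      using that assms(1) unfolding orthonormal_def by fastforce
    ultimately show False
      using assms(2,3) inj by (simp add: card_image)
  qed
  show expand: "(\<Sum>a\<in>I. cinner (e a) x *s e a) = x" for x
    using zero[of "x - (\<Sum>a\<in>I. cinner (e a) x *s e a)"] cinner_projection[OF assms(1,2), of _ x]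
    by (simp add: cinner_diff_right)
  have "x \<in> vec.span (e ` I)" for x
    by (subst expand[symmetric]) (intro vec.span_sum vec.span_scale vec.span_base, auto)
  then show "orthonormal_basis I e"
    using assms(1) by (auto simp: orthonormal_basis_def orthonormal_def)
qed

subsection \<open>The canonical form of an antisymmetric conjugate-bilinear form\<close>

text \<open>The inner product of the tensor product of \<open>x\<close> and \<open>y\<close> with
  the tensor of coefficients \<open>w\<close>. Conjugating both arguments makes its values on an
  orthonormal basis the coefficients in that basis.\<close>

definition conj_form :: "('n \<Rightarrow> 'n \<Rightarrow> complex) \<Rightarrow> complex ^ 'n \<Rightarrow> complex ^ 'n \<Rightarrow> complex" where
  "conj_form w x y = (\<Sum>i\<in>UNIV. \<Sum>j\<in>UNIV. w i j * cnj (x $ i) * cnj (y $ j))"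

lemma conj_form_add_right: "conj_form w x (y + y') = conj_form w x y + conj_form w x y'"
  by (simp add: conj_form_def distrib_left sum.distrib)

lemma conj_form_scale_right: "conj_form w x (c *s y) = cnj c * conj_form w x y"
  by (simp add: conj_form_def sum_distrib_left mult_ac)

lemma conj_form_swap:
  assumes "\<And>i j. w i j = - w j i"
  shows "conj_form w x y = - conj_form w y x"
proof -
  have "conj_form w x y = (\<Sum>i\<in>UNIV. \<Sum>j\<in>UNIV. - (w j i * cnj (y $ j) * cnj (x $ i)))"
    unfolding conj_form_def by (intro sum.cong refl) (subst assms, simp add: mult_ac)
  also have "\<dots> = - conj_form w y x"
    unfolding conj_form_def by (subst sum.swap) (simp add: sum_negf)
  finally show ?thesis .
qed

lemma conj_form_self:
  assumes "\<And>i j. w i j = - w j i"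
  shows "conj_form w x x = 0"
  using conj_form_swap[of w x x, OF assms] by simp

section \<open>Extremal orthonormal pairs and their iterated splitting\<close>

text \<open>The admissible pairs form a compact set, nonempty because at least two dimensions
  remain, on which the modulus of the form is continuous.\<close>

lemma conj_form_maximal_pair:
  fixes w :: "'n::finite \<Rightarrow> 'n \<Rightarrow> complex" and e :: "'i \<Rightarrow> complex ^ 'n"
  assumes on: "orthonormal I e" and fin: "finite I" and card: "card I + 1 < CARD('n)"
  obtains u v where "norm u = 1" "norm v = 1" "cinner u v = 0"
    "\<forall>a\<in>I. cinner (e a) u = 0" "\<forall>a\<in>I. cinner (e a) v = 0"
    "\<And>x y. norm x = 1 \<Longrightarrow> norm y = 1 \<Longrightarrow> cinner x y = 0 \<Longrightarrow> \<forall>a\<in>I. cinner (e a) x = 0 \<Longrightarrow>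
      \<forall>a\<in>I. cinner (e a) y = 0 \<Longrightarrow> cmod (conj_form w x y) \<le> cmod (conj_form w u v)"
proof -
  let ?S = "(sphere 0 1 \<times> sphere 0 1) \<inter> {p. cinner (fst p) (snd p) = 0} \<inter>
    {p. \<forall>a\<in>I. cinner (e a) (fst p) = 0} \<inter> {p. \<forall>a\<in>I. cinner (e a) (snd p) = 0}"
  have cpt: "compact ?S"
    unfolding cinner_def Ball_def
    by (intro compact_Int_closed compact_Times compact_sphere closed_Collect_eq
        closed_Collect_all closed_Collect_imp continuous_intros) auto
  have ne: "?S \<noteq> {}"
  proof -
    obtain x where x: "norm x = 1" "\<forall>a\<in>I. cinner (e a) x = 0"
      using orthonormal_extend[OF on fin] card by auto
    \<comment> \<open>\<open>None\<close> is a fresh index for \<open>x\<close>; the type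
      \<open>'i\<close> may have no element outside \<open>I\<close>.\<close>
    let ?e = "case_option x e" and ?J = "insert None (Some ` I)"
    have "orthonormal ?J ?e"
      using on x by (intro orthonormal_insert) (auto simp: orthonormal_def)
    moreover have "card ?J = card I + 1"
      using fin by (simp add: card_insert_disjoint card_image)
    ultimately obtain y where "norm y = 1" "\<forall>a\<in>?J. cinner (?e a) y = 0"
      using orthonormal_extend[of ?J ?e] fin card by auto
    with x have "(x, y) \<in> ?S" by auto
    then show ?thesis by blast
  qed
  have "continuous_on ?S (\<lambda>p. cmod (conj_form w (fst p) (snd p)))"
    unfolding conj_form_def by (intro continuous_intros)
  from continuous_attains_sup[OF cpt ne this] obtain p where p: "p \<in> ?S"
    and max: "\<forall>q\<in>?S. cmod (conj_form w (fst q) (snd q)) \<le> cmod (conj_form w (fst p) (snd p))"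
    by (elim bexE)
  show ?thesis
  proof (rule that)
    fix x y :: "complex ^ 'n"
    assume "norm x = 1" "norm y = 1" "cinner x y = 0" "\<forall>a\<in>I. cinner (e a) x = 0"
      "\<forall>a\<in>I. cinner (e a) y = 0"
    then have "(x, y) \<in> ?S" by simp
    from bspec[OF max this] show "cmod (conj_form w x y) \<le> cmod (conj_form w (fst p) (snd p))"
      by simp
  qed (use p in auto)
qed

text \<open>
  Write \<open>B\<close> for \<open>conj_form w\<close>.  Maximality is tested on the vector \<open>B(u,v) v + B(u,y) y\<close>, on which
  \<open>B(u, _)\<close> takes the value \<open>sqrt (|B(u,v)|\<^sup>2 + |B(u,y)|\<^sup>2)\<close> after normalization.
\<close>

lemma conj_form_eq_0_of_maximal:
  assumes v: "norm v = 1" and y: "norm y = 1" and vy: "cinner v y = 0"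
    and max: "\<And>c d. norm (c *s v + d *s y) = 1 \<Longrightarrow>
      cmod (conj_form w u (c *s v + d *s y)) \<le> cmod (conj_form w u v)"
  shows "conj_form w u y = 0"
proof (rule ccontr)
  let ?\<alpha> = "conj_form w u v" and ?\<beta> = "conj_form w u y"
  let ?s = "(cmod ?\<alpha>)\<^sup>2 + (cmod ?\<beta>)\<^sup>2"
  define r where "r = complex_of_real (inverse (sqrt ?s))"
  assume "?\<beta> \<noteq> 0"
  then have s: "?s > (cmod ?\<alpha>)\<^sup>2" "?s > 0" by (auto intro: add_nonneg_pos)
  have *: "cnj c * c = complex_of_real ((cmod c)\<^sup>2)" for c
    by (simp add: cnj_mult_self)
  \<comment> \<open>The form is antilinear in its second argument, so the unconjugated coefficients
    \<open>?\<alpha>\<close> and \<open>?\<beta>\<close> produce squared moduli.\<close>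
  let ?x = "(r * ?\<alpha>) *s v + (r * ?\<beta>) *s y"
  have rr: "cnj r * r * complex_of_real ?s = 1"
  proof -
    have "inverse (sqrt ?s) * inverse (sqrt ?s) * ?s = 1"
      using s(2) by (metis inverse_mult_distrib less_imp_le less_irrefl left_inverse real_sqrt_mult_self abs_of_nonneg)
    then show ?thesis unfolding r_def complex_cnj_complex_of_real
      by (metis of_real_mult of_real_1)
  qed
  have "cinner y v = 0" using vy cinner_eq_0_commute by blast
  then have "cinner ?x ?x = cnj r * r * (cnj ?\<alpha> * ?\<alpha> + cnj ?\<beta> * ?\<beta>)"
    using v y vy cinner_self_eq_1[of v] cinner_self_eq_1[of y]
    by (simp add: cinner_add_left cinner_add_right cinner_scale_left cinner_scale_right algebra_simps)
  also have "\<dots> = 1" using rr by (simp add: *)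
  finally have "norm ?x = 1" by (simp only: cinner_self_eq_1)
  from max[OF this] have le: "cmod (conj_form w u ?x) \<le> cmod ?\<alpha>" .
  have "conj_form w u ?x = r * (cnj ?\<alpha> * ?\<alpha> + cnj ?\<beta> * ?\<beta>)"
    by (simp add: conj_form_add_right conj_form_scale_right algebra_simps r_def)
  also have "\<dots> = complex_of_real (sqrt ?s)"
    using s(2) unfolding * r_def of_real_add[symmetric] of_real_mult[symmetric]
    by (metis inverse_eq_divide mult.commute real_div_sqrt less_imp_le times_divide_eq_right mult_1_right)
  finally have "sqrt ?s \<le> cmod ?\<alpha>" using le s(2) by simp
  then have "?s \<le> (cmod ?\<alpha>)\<^sup>2" by (rule sqrt_le_D)
  then show False using s(1) by simp
qed

text \<open>A unit combination of \<open>v\<close> and \<open>y\<close> is again orthogonal to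
  \<open>u\<close> and to the family, so it competes with \<open>v\<close> as partner of
  \<open>u\<close>, and maximality forces \<open>conj_form w u y = 0\<close>. Exchanging
  \<open>u\<close> and \<open>v\<close> gives the other half.\<close>

lemma conj_form_split_pair:
  fixes w :: "'n::finite \<Rightarrow> 'n \<Rightarrow> complex" and e :: "'i \<Rightarrow> complex ^ 'n"
  assumes w: "\<And>i j. w i j = - w j i"
    and on: "orthonormal I e" and fin: "finite I" and card: "card I + 1 < CARD('n)"
  obtains u v where "norm u = 1" "norm v = 1" "cinner u v = 0"
    "\<forall>a\<in>I. cinner (e a) u = 0" "\<forall>a\<in>I. cinner (e a) v = 0"
    "\<And>y. \<forall>a\<in>I. cinner (e a) y = 0 \<Longrightarrow> cinner u y = 0 \<Longrightarrow> cinner v y = 0 \<Longrightarrow>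
      conj_form w u y = 0 \<and> conj_form w v y = 0"
proof -
  obtain u v where uv: "norm u = 1" "norm v = 1" "cinner u v = 0"
    "\<forall>a\<in>I. cinner (e a) u = 0" "\<forall>a\<in>I. cinner (e a) v = 0"
    and max: "\<And>x y. norm x = 1 \<Longrightarrow> norm y = 1 \<Longrightarrow> cinner x y = 0 \<Longrightarrow> \<forall>a\<in>I. cinner (e a) x = 0 \<Longrightarrow>
      \<forall>a\<in>I. cinner (e a) y = 0 \<Longrightarrow> cmod (conj_form w x y) \<le> cmod (conj_form w u v)"
    using conj_form_maximal_pair[OF on fin card] by blast
  have vu: "cinner v u = 0" using uv(3) cinner_eq_0_commute by blast
  have unit: "conj_form w u y = 0 \<and> conj_form w v y = 0"
    if y: "norm y = 1" "\<forall>a\<in>I. cinner (e a) y = 0" "cinner u y = 0" "cinner v y = 0" for y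
  proof
    show "conj_form w u y = 0"
      using uv y by (intro conj_form_eq_0_of_maximal[of v y] max)
        (auto simp: cinner_add_right cinner_scale_right)
    \<comment> \<open>Exchanging the arguments keeps the modulus, so the same maximum bounds the
      pairs of \<open>v\<close> with combinations of \<open>u\<close> and \<open>y\<close>.\<close>
    have "cmod (conj_form w v x) = cmod (conj_form w x v)" for x
      by (subst conj_form_swap[of w, OF w]) simp
    moreover have "cinner v (c *s u + d *s y) = 0" for c d
      using vu y by (simp add: cinner_add_right cinner_scale_right)
    ultimately show "conj_form w v y = 0"
      using uv y cinner_eq_0_commute[of _ v]
      by (intro conj_form_eq_0_of_maximal[of u y])
         (auto simp: cinner_add_right cinner_scale_right intro!: max)
  qed
  have "conj_form w u y = 0 \<and> conj_form w v y = 0"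
    if y: "\<forall>a\<in>I. cinner (e a) y = 0" "cinner u y = 0" "cinner v y = 0" for y
  proof (cases "y = 0")
    case True
    then show ?thesis by (simp add: conj_form_def)
  next
    case False
    define c where "c = complex_of_real (inverse (norm y))"
    have "norm (c *s y) = 1"
      unfolding c_def using False by (rule norm_normalize)
    then have "conj_form w u (c *s y) = 0 \<and> conj_form w v (c *s y) = 0"
      using y by (intro unit) (auto simp: cinner_scale_right)
    then show ?thesis using False by (simp add: conj_form_scale_right c_def)
  qed
  then show ?thesis using that uv by blast
qed

text \<open>Each induction step splits a pair off the orthogonal complement of the preceding ones.
  Quantifying over all \<open>y\<close> orthogonal to the first \<open>2 * i\<close> vectors, rather
  than over later basis vectors, keeps the property stable under extension of the family.\<close>

lemma conj_form_flag:
  fixes w :: "'n::finite \<Rightarrow> 'n \<Rightarrow> complex"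
  assumes w: "\<And>i j. w i j = - w j i" and "2 * m \<le> CARD('n)"
  shows "\<exists>e :: nat \<Rightarrow> complex ^ 'n. orthonormal {1..2 * m} e \<and>
    (\<forall>i\<in>{1..m}. \<forall>y. (\<forall>b\<in>{1..2 * i}. cinner (e b) y = 0) \<longrightarrow>
      conj_form w (e (2 * i - 1)) y = 0 \<and> conj_form w (e (2 * i)) y = 0)"
  using assms(2)
proof (induction m)
  case 0
  then show ?case by (simp add: orthonormal_def)
next
  case (Suc m)
  then obtain e :: "nat \<Rightarrow> complex ^ 'n" where on: "orthonormal {1..2 * m} e"
    and flag: "\<And>i y. i \<in> {1..m} \<Longrightarrow> \<forall>b\<in>{1..2 * i}. cinner (e b) y = 0 \<Longrightarrow>
      conj_form w (e (2 * i - 1)) y = 0 \<and> conj_form w (e (2 * i)) y = 0"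
    by auto
  have card: "card {1..2 * m} + 1 < CARD('n)" using Suc.prems by simp
  obtain u v where uv: "norm u = 1" "norm v = 1" "cinner u v = 0"
    "\<forall>a\<in>{1..2 * m}. cinner (e a) u = 0" "\<forall>a\<in>{1..2 * m}. cinner (e a) v = 0"
    and split: "\<And>y. \<forall>a\<in>{1..2 * m}. cinner (e a) y = 0 \<Longrightarrow> cinner u y = 0 \<Longrightarrow> cinner v y = 0 \<Longrightarrow>
      conj_form w u y = 0 \<and> conj_form w v y = 0"
    using conj_form_split_pair[of w "{1..2 * m}" e, OF w on finite_atLeastAtMost card] by blast
  \<comment> \<open>The new pair sits just past index \<open>2 * m\<close>, so the conditions for
    \<open>i \<le> m\<close> speak of unchanged vectors.\<close>
  define e' where "e' = e(2 * m + 1 := u, 2 * m + 2 := v)"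
  have I: "{1..2 * Suc m} = insert (Suc (Suc (2 * m))) (insert (Suc (2 * m)) {1..2 * m})"
    by auto
  have e'_old: "e' a = e a" if "a \<in> {1..2 * m}" for a
    using that by (auto simp: e'_def)
  have e'_new: "e' (Suc (2 * m)) = u" "e' (Suc (Suc (2 * m))) = v"
    by (auto simp: e'_def)
  have "orthonormal {1..2 * m} e'"
    using on e'_old unfolding orthonormal_def by metis
  then have "orthonormal (insert (Suc (2 * m)) {1..2 * m}) e'"
    by (rule orthonormal_insert) (use uv e'_new e'_old in metis)+
  then have "orthonormal (insert (Suc (Suc (2 * m))) (insert (Suc (2 * m)) {1..2 * m})) e'"
    by (rule orthonormal_insert) (use uv e'_new e'_old in \<open>metis insertE\<close>)+
  then have "orthonormal {1..2 * Suc m} e'" unfolding I .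
  moreover have "conj_form w (e' (2 * i - 1)) y = 0 \<and> conj_form w (e' (2 * i)) y = 0"
    if i: "i \<in> {1..Suc m}" and y: "\<forall>b\<in>{1..2 * i}. cinner (e' b) y = 0" for i y
  proof (cases "i = Suc m")
    case True
    have y': "cinner (e' b) y = 0" if "b \<in> {1..2 * Suc m}" for b
      using y that unfolding True by blast
    have "cinner (e a) y = 0" if "a \<in> {1..2 * m}" for a
      using y'[of a] e'_old[OF that] that by auto
    moreover have "cinner u y = 0" "cinner v y = 0"
      using y'[of "Suc (2 * m)"] y'[of "Suc (Suc (2 * m))"] by (simp_all add: e'_new)
    ultimately show ?thesis using split[of y] by (simp add: True e'_new)
  next
    case False
    then have im: "i \<in> {1..m}" using i by auto
    then have "e' b = e b" if "b \<in> {1..2 * i}" for b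
      using that by (intro e'_old) auto
    moreover from this have "\<forall>b\<in>{1..2 * i}. cinner (e b) y = 0"
      using y by metis
    ultimately show ?thesis
      using flag[OF im] im by auto
  qed
  ultimately show ?case by blast
qed

section \<open>Expansion in a basis of pairs, and its norm\<close>

lemma sum_pairs:
  fixes f :: "nat \<Rightarrow> 'b::comm_monoid_add"
  shows "(\<Sum>a=1..2 * m. f a) = (\<Sum>i=1..m. f (2 * i - 1) + f (2 * i))"
  by (induction m) (auto simp: add_ac)

lemma conj_form_expand:
  assumes "\<And>x. (\<Sum>a\<in>I. cinner (e a) x *s e a) = x"
  shows "w i j = (\<Sum>a\<in>I. \<Sum>b\<in>I. conj_form w (e a) (e b) * (e a $ i) * (e b $ j))"
proof -
  \<comment> \<open>The completeness relation, read off as coordinate \<open>i\<close> of the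
    expansion of the axis vector \<open>k\<close>. It is applied below in both tensor
    indices.\<close>
  have delta: "(\<Sum>a\<in>I. cnj (e a $ k) * e a $ i) = (if k = i then 1 else 0)" for i k
  proof -
    have "cinner (e a) (axis k 1) = cnj (e a $ k)" for a
      by (simp add: cinner_def axis_def if_distrib cong: if_cong)
    then show ?thesis
      using arg_cong[OF assms[of "axis k 1"], of "\<lambda>x. x $ i"] by (simp add: axis_def eq_commute)
  qed
  have "(\<Sum>a\<in>I. \<Sum>b\<in>I. conj_form w (e a) (e b) * (e a $ i) * (e b $ j)) =
      (\<Sum>a\<in>I. \<Sum>b\<in>I. \<Sum>k\<in>UNIV. \<Sum>l\<in>UNIV. w k l * (cnj (e a $ k) * e a $ i) * (cnj (e b $ l) * e b $ j))"
    by (simp add: conj_form_def sum_distrib_left sum_distrib_right mult_ac)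
  also have "\<dots> = (\<Sum>k\<in>UNIV. \<Sum>l\<in>UNIV. \<Sum>a\<in>I. \<Sum>b\<in>I. w k l * (cnj (e a $ k) * e a $ i) * (cnj (e b $ l) * e b $ j))"
    by (simp only: sum.swap[of _ UNIV I])
  also have "\<dots> = (\<Sum>k\<in>UNIV. \<Sum>l\<in>UNIV. w k l * (\<Sum>a\<in>I. cnj (e a $ k) * e a $ i) * (\<Sum>b\<in>I. cnj (e b $ l) * e b $ j))"
    by (simp add: sum_distrib_left sum_distrib_right mult_ac)
  also have "\<dots> = w i j"
    by (simp add: delta mult_delta_right)
  finally show ?thesis ..
qed

text \<open>By the flag property the form vanishes between an earlier and a later pair, and
  antisymmetry covers the reverse order. One antisymmetric 2 by 2 block per pair remains.\<close>

lemma antisymmetric_canonical_form: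
  fixes w :: "'n::finite \<Rightarrow> 'n \<Rightarrow> complex"
  assumes w: "\<And>i j. w i j = - w j i" and card: "CARD('n) = 2 * K"
  obtains e :: "nat \<Rightarrow> complex ^ 'n" where "orthonormal_basis {1..2 * K} e"
    "\<And>j k. w j k = (\<Sum>i=1..K. conj_form w (e (2 * i - 1)) (e (2 * i)) *
      (e (2 * i - 1) $ j * e (2 * i) $ k - e (2 * i) $ j * e (2 * i - 1) $ k))"
proof -
  obtain e :: "nat \<Rightarrow> complex ^ 'n" where on: "orthonormal {1..2 * K} e"
    and flag: "\<And>i y. i \<in> {1..K} \<Longrightarrow> \<forall>b\<in>{1..2 * i}. cinner (e b) y = 0 \<Longrightarrow>
      conj_form w (e (2 * i - 1)) y = 0 \<and> conj_form w (e (2 * i)) y = 0"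
    using conj_form_flag[of w K, OF w] card by auto
  note basis = orthonormal_spanning[OF on]
  have later: "conj_form w (e (2 * i - 1)) (e b) = 0 \<and> conj_form w (e (2 * i)) (e b) = 0"
    if "i \<in> {1..K}" "b \<in> {2 * i<..2 * K}" for i b
    using that on by (intro flag) (auto simp: orthonormal_def)
  have off: "conj_form w (e (2 * i - 1)) (e b) = 0 \<and> conj_form w (e (2 * i)) (e b) = 0"
    if i: "i \<in> {1..K}" and b: "b \<in> {1..2 * K}" "b \<noteq> 2 * i - 1" "b \<noteq> 2 * i" for i b
  proof (cases "b > 2 * i")
    case True
    then show ?thesis using later[of i b] i b by auto
  next
    case False
    \<comment> \<open>Here \<open>b < 2 * i - 1\<close>, and \<open>l\<close> numbers the pair
      containing \<open>b\<close>. This pair is earlier, so \<open>later\<close> applies with the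
      arguments exchanged.\<close>
    define l where "l = (b + 1) div 2"
    have l: "l \<in> {1..K}" "b = 2 * l - 1 \<or> b = 2 * l" "2 * l < 2 * i - 1"
      using i b False unfolding l_def by auto presburger+
    then have "conj_form w (e b) (e (2 * i - 1)) = 0" "conj_form w (e b) (e (2 * i)) = 0"
      using later[of l "2 * i - 1"] later[of l "2 * i"] i by auto
    then show ?thesis by (simp add: conj_form_swap[of w _ "e b", OF w])
  qed
  let ?c = "\<lambda>i. conj_form w (e (2 * i - 1)) (e (2 * i))"
  have "w j k = (\<Sum>i=1..K. ?c i *
      (e (2 * i - 1) $ j * e (2 * i) $ k - e (2 * i) $ j * e (2 * i - 1) $ k))" for j k
  proof -
    \<comment> \<open>Only the partner's column survives in each row: the diagonal entry vanishes by
      \<open>conj_form_self\<close>, the other columns by \<open>off\<close>.\<close>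
    have row: "(\<Sum>b\<in>{1..2 * K}. conj_form w (e (2 * i - 1)) (e b) * (e (2 * i - 1) $ j) * (e b $ k)) =
          ?c i * e (2 * i - 1) $ j * e (2 * i) $ k" (is ?A)
      "(\<Sum>b\<in>{1..2 * K}. conj_form w (e (2 * i)) (e b) * (e (2 * i) $ j) * (e b $ k)) =
          - ?c i * e (2 * i) $ j * e (2 * i - 1) $ k" (is ?B) if i: "i \<in> {1..K}" for i
    proof -
      have "(\<Sum>b\<in>{1..2 * K}. conj_form w (e (2 * i - 1)) (e b) * (e (2 * i - 1) $ j) * (e b $ k)) =
          (\<Sum>b\<in>{2 * i}. conj_form w (e (2 * i - 1)) (e b) * (e (2 * i - 1) $ j) * (e b $ k))"
        using i off[OF i] conj_form_self[of w, OF w] by (intro sum.mono_neutral_right) (auto, metis)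
      then show ?A by simp
      have "(\<Sum>b\<in>{1..2 * K}. conj_form w (e (2 * i)) (e b) * (e (2 * i) $ j) * (e b $ k)) =
          (\<Sum>b\<in>{2 * i - 1}. conj_form w (e (2 * i)) (e b) * (e (2 * i) $ j) * (e b $ k))"
        using i off[OF i] conj_form_self[of w, OF w] by (intro sum.mono_neutral_right) (auto, metis)
      then show ?B using conj_form_swap[of w "e (2 * i)" "e (2 * i - 1)", OF w] by simp
    qed
    have "w j k = (\<Sum>a=1..2 * K. \<Sum>b=1..2 * K. conj_form w (e a) (e b) * (e a $ j) * (e b $ k))"
      using basis(2) card by (intro conj_form_expand) auto
    also have "\<dots> = (\<Sum>i=1..K. ?c i * e (2 * i - 1) $ j * e (2 * i) $ k +
        - ?c i * e (2 * i) $ j * e (2 * i - 1) $ k)"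
      unfolding sum_pairs[of _ K, of "\<lambda>a. \<Sum>b=1..2 * K. conj_form w (e a) (e b) * (e a $ j) * (e b $ k)"]
      by (intro sum.cong refl arg_cong2[of _ _ _ _ "(+)"] row)
    finally show ?thesis by (simp add: algebra_simps)
  qed
  then show ?thesis using that basis(1) card by auto
qed

text \<open>With the decomposition substituted into the unconjugated factor only, the sums over
  \<open>j\<close> and \<open>k\<close> reassemble into conjugated values of the form. The two
  orders of a pair contribute equally, hence the factor 2.\<close>

lemma antisymmetric_canonical_norm:
  fixes w :: "'n::finite \<Rightarrow> 'n \<Rightarrow> complex"
  assumes w: "\<And>i j. w i j = - w j i"
    and eq: "\<And>j k. w j k = (\<Sum>i\<in>I. conj_form w (u i) (v i) * (u i $ j * v i $ k - v i $ j * u i $ k))"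
  shows "(\<Sum>j\<in>UNIV. \<Sum>k\<in>UNIV. cnj (w j k) * w j k) =
    complex_of_real (\<Sum>i\<in>I. 2 * (cmod (conj_form w (u i) (v i)))\<^sup>2)"
proof -
  let ?c = "\<lambda>i. conj_form w (u i) (v i)"
  have form: "cnj (conj_form w x y) = (\<Sum>j\<in>UNIV. \<Sum>k\<in>UNIV. cnj (w j k) * (x $ j * y $ k))" for x y
    by (simp add: conj_form_def mult_ac)
  have "(\<Sum>j\<in>UNIV. \<Sum>k\<in>UNIV. cnj (w j k) * w j k) =
      (\<Sum>j\<in>UNIV. \<Sum>k\<in>UNIV. \<Sum>i\<in>I. ?c i * (cnj (w j k) * (u i $ j * v i $ k) - cnj (w j k) * (v i $ j * u i $ k)))"
    by (subst (2) eq) (simp add: sum_distrib_left algebra_simps)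
  also have "\<dots> = (\<Sum>i\<in>I. \<Sum>j\<in>UNIV. \<Sum>k\<in>UNIV. ?c i * (cnj (w j k) * (u i $ j * v i $ k) - cnj (w j k) * (v i $ j * u i $ k)))"
    by (simp only: sum.swap[of _ I UNIV])
  also have "\<dots> = (\<Sum>i\<in>I. ?c i * (cnj (?c i) - cnj (conj_form w (v i) (u i))))"
    unfolding form by (simp add: sum_distrib_left sum_subtractf right_diff_distrib)
  also have "\<dots> = (\<Sum>i\<in>I. complex_of_real (2 * (cmod (?c i))\<^sup>2))"
    unfolding conj_form_swap[of w "v _", OF w] by (simp add: mult_ac flip: cnj_mult_self)
  finally show ?thesis by simp
qed

subsection \<open>The Slater decomposition\<close>

theorem lemma2:
  fixes K :: nat and \<Psi> :: "'n::finite fock"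
  assumes "K \<ge> 1" and "CARD('n) = 2 * K"
    and "\<Psi> \<in> antisym_space 2" and "tensor_inner 2 \<Psi> \<Psi> = 1"
  shows "\<exists>(e :: nat \<Rightarrow> complex ^ 'n) (a :: nat \<Rightarrow> nat \<Rightarrow> nat) (z :: nat \<Rightarrow> complex).
      orthonormal_basis {1..2 * K} e \<and>
      bij_betw (\<lambda>(s, i). a s i) ({1, 2} \<times> {1..K}) {1..2 * K} \<and>
      orthonormal_basis ({1, 2} \<times> {1..K}) (\<lambda>(s, i). one_particle (creation (e (a s i)) vacuum)) \<and>
      \<Psi> = (\<lambda>is. 1 / complex_of_real (sqrt (\<Sum>i=1..K. (cmod (z i))\<^sup>2)) *
              (\<Sum>i=1..K. z i * creation (e (a 1 i)) (creation (e (a 2 i)) vacuum) is))"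
proof -
  define w where "w i j = \<Psi> [i, j]" for i j
  have \<Psi>: "\<And>is. length is \<noteq> 2 \<Longrightarrow> \<Psi> is = 0" and w: "\<And>i j. w i j = - w j i"
    using assms(3) unfolding antisym_space_2_iff w_def by blast+
  obtain e :: "nat \<Rightarrow> complex ^ 'n" where basis: "orthonormal_basis {1..2 * K} e"
    and form: "\<And>j k. w j k = (\<Sum>i=1..K. conj_form w (e (2 * i - 1)) (e (2 * i)) *
      (e (2 * i - 1) $ j * e (2 * i) $ k - e (2 * i) $ j * e (2 * i - 1) $ k))"
    using antisymmetric_canonical_form[of w K, OF w assms(2)] by blast
  \<comment> \<open>Thus \<open>a 1 i = 2 * i - 1\<close> and \<open>a 2 i = 2 * i\<close>, as in
    the canonical form.\<close>
  define a :: "nat \<Rightarrow> nat \<Rightarrow> nat" where "a s i = 2 * i + s - 2" for s i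
  let ?a = "\<lambda>(s, i). a s i" and ?I = "{1, 2} \<times> {1..K}"
  \<comment> \<open>The factor \<open>sqrt 2\<close> cancels the \<open>1 / sqrt 2\<close> of the
    Slater determinant and absorbs the 2 of the norm formula.\<close>
  define z where "z i = complex_of_real (sqrt 2) * conj_form w (e (2 * i - 1)) (e (2 * i))" for i
  have bij: "bij_betw ?a ?I {1..2 * K}"
  \<comment> \<open>The parity of \<open>b\<close> tells the member of the pair, odd for the first
    and even for the second; \<open>(b + 1) div 2\<close> is the number of the pair.\<close>
  proof (rule bij_betw_byWitness[where f' = "\<lambda>b. (2 - b mod 2, (b + 1) div 2)"])
    show "?a ` ?I \<subseteq> {1..2 * K}" by (auto simp: a_def)
    show "(\<lambda>b. (2 - b mod 2, (b + 1) div 2)) ` {1..2 * K} \<subseteq> ?I" by auto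
    have "(2 - a s i mod 2, (a s i + 1) div 2) = (s, i)" if "s \<in> {1, 2}" "i \<ge> 1" for s i
      using that by (cases i) (auto simp: a_def)
    then show "\<forall>p\<in>?I. (2 - ?a p mod 2, (?a p + 1) div 2) = p"
      by auto
    have "a (2 - b mod 2) ((b + 1) div 2) = b" for b
      by (cases "even b") (auto simp: a_def elim!: evenE oddE)
    then show "\<forall>b\<in>{1..2 * K}. ?a (2 - b mod 2, (b + 1) div 2) = b"
      by auto
  qed
  have "(\<Sum>j\<in>UNIV. \<Sum>k\<in>UNIV. cnj (w j k) * w j k) = 1"
  proof -
    have "tensor_inner 2 \<Psi> \<Psi> = (\<Sum>j\<in>UNIV. \<Sum>k\<in>UNIV. cnj (w j k) * w j k)"
      unfolding tensor_inner_def numeral_2_eq_2 sum_length_Suc by (simp add: w_def)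
    then show ?thesis using assms(4) by simp
  qed
  \<comment> \<open>Since \<open>\<Psi>\<close> is normalized, the prefactor in the claim equals
    1.\<close>
  then have norm: "(\<Sum>i=1..K. (cmod (z i))\<^sup>2) = 1"
    using antisymmetric_canonical_norm[where I = "{1..K}", OF w form]
    by (simp add: z_def norm_mult power_mult_distrib of_real_eq_1_iff del: of_real_sum)
  have "orthonormal_basis ?I (\<lambda>(s, i). one_particle (creation (e (a s i)) vacuum))"
  proof -
    \<comment> \<open>The single-particle states are the vectors \<open>e\<close> themselves,
      reindexed along the bijection \<open>?a\<close>.\<close>
    have "(\<lambda>(s, i). one_particle (creation (e (a s i)) vacuum)) = e \<circ> ?a"
      by (auto simp: one_particle_creation_vacuum)
    moreover have "?a p = ?a q \<longleftrightarrow> p = q" if "p \<in> ?I" "q \<in> ?I" for p q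
      using bij that unfolding bij_betw_def inj_on_def by blast
    moreover have "?a p \<in> {1..2 * K}" if "p \<in> ?I" for p
      using bij that unfolding bij_betw_def by blast
    moreover have "(e \<circ> ?a) ` ?I = e ` {1..2 * K}"
      using bij by (simp only: bij_betw_def image_comp[symmetric])
    ultimately show ?thesis
      using basis unfolding orthonormal_basis_def by (simp only: o_apply) metis
  qed
  moreover have "\<Psi> is = (\<Sum>i=1..K. z i * creation (e (a 1 i)) (creation (e (a 2 i)) vacuum) is)"
    for "is"
  proof (cases "length is = 2")
    case True
    then obtain j k where "is = [j, k]"
      by (auto simp: numeral_2_eq_2 length_Suc_conv)
    moreover have "\<Psi> [j, k] = w j k" by (simp add: w_def)
    ultimately show ?thesis
      by (simp only: form) (simp add: slater_determinant tensor2_def z_def a_def)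
  next
    case False
    then show ?thesis by (simp add: \<Psi> slater_determinant tensor2_def)
  qed
  ultimately show ?thesis
    using basis bij norm by (intro exI[of _ e] exI[of _ a] exI[of _ z]) auto
qed

end
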